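(* Let $X$ be a complete separable metric space and let $\pi$ be a Radon kernel from $\mathcal M^{\cdot\cdot}(X)$ to $X$ such that: (i) (cocycle condition) for every $\mu\in\mathcal M^{\cdot\cdot}(X)$, the equality of measures on $X\times X$ $$\pi(\mu+\delta_y,\mathrm dx)\,\pi(\mu,\mathrm dy)=\pi(\mu+\delta_x,\mathrm dy)\,\pi(\mu,\mathrm dx)$$ holds; (ii) for every $y\in X$ and every $\mu\in\mathcal M^{\cdot\cdot}(X)$, $\pi(\mu+\delta_y,\mathrm dx)=\pi(\mu,\mathrm dx)$ on $X\setminus\{y\}$; (iii) $\pi$ is vaguely continuous. Then there exist a Radon measure $\varrho\in\mathcal M(X)$ and a measurable function $c:X\times\mathbb N\to\mathbb R$, $(x,n)\mapsto c_x(n)$, such that $$\pi(\mu,\,\cdot\,)=\varrho+\sum_{x\in\operatorname{supp}\mu}c_x\bigl(\mu(\{x\})\bigr)\,\delta_x ,\qquad \mu\in\mathcal M^{\cdot\cdot}(X).$$ In particular, $\varrho=\pi(0,\,\cdot\,)$ and $c$ is the (signed) density $c_x(n)=\pi(n\delta_x,\{x\})-\pi\bigl((n-1)\delta_x,\{x\}\bigr)$.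
   Context: Let $X$ be a complete separable metric space with Borel $\sigma$-field $\mathcal B(X)$, and let $\mathcal B_0(X)$ be the ring of (metrically) bounded Borel sets. $\mathcal M(X)$ is the set of Radon measures, meaning Borel measures that are finite on every $B\in\mathcal B_0(X)$. It carries the vague topology: $\mu_k\to\mu$ iff $\int f\,\mathrm d\mu_k\to\int f\,\mathrm d\mu$ for every bounded continuous $f:X\to\mathbb R$ with bounded support. $\mathcal M^{\cdot\cdot}(X)\subset\mathcal M(X)$ is the measurable subset of point measures, i.e. those $\mu\in\mathcal M(X)$ with $\mu(B)\in\mathbb N\cup\{+\infty\}$ for all $B\in\mathcal B(X)$ (with $0\in\mathbb N$); $0$ also denotes the zero measure, and $\delta_x$ is the Dirac measure at $x$. A Radon kernel from $\mathcal M^{\cdot\cdot}(X)$ to $X$ is a map $\pi$ assigning to $\mu\in\mathcal M^{\cdot\cdot}(X)$ and $B\in\mathcal B(X)$ a nonnegative value $\pi(\mu,B)$ such that $\pi(\mu,\cdot)\in\mathcal M(X)$ for each $\mu$, and $\mu\mapsto\pi(\mu,B)$ is measurable for each $B\in\mathcal B(X)$. It is vaguely continuous if $\mu\mapsto\pi(\mu,\cdot)$ is continuous from $\mathcal M^{\cdot\cdot}(X)$ to $\mathcal M(X)$, both with the vague topology.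
   Formalization: The displayed formula for c_x(n) fails for n ≥ 2 (e.g. π(μ,·)=ϱ+μ has c_x(2)=2, not 1); it is proved instead, for n ≥ 1, that c_x(n) is the sum over k=1,…,n of π(kδ_x,{x})−π((k−1)δ_x,{x}); c_x(0) is left unspecified. *)

theory Defs
  imports "HOL-Probability.Probability"
begin

definition radon_measures :: "'a::polish_space measure set" where
  "radon_measures =
     {\<mu>. sets \<mu> = sets borel \<and> (\<forall>B\<in>sets borel. bounded B \<longrightarrow> emeasure \<mu> B < \<infinity>)}"

definition point_measures :: "'a::polish_space measure set" where
  "point_measures =
     {\<mu> \<in> radon_measures. \<forall>B\<in>sets borel. emeasure \<mu> B \<in> range of_nat \<union> {\<infinity>}}"

definition vague_test_functions :: "('a::polish_space \<Rightarrow> real) set" where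
  "vague_test_functions =
     {f. continuous_on UNIV f \<and> bounded (range f) \<and> bounded {x. f x \<noteq> 0}}"

(* The coarsest topology on the Radon measures that makes all the maps
   \<mu> \<mapsto> \<integral>f d\<mu>, f a test function, continuous; see limitin_vague_topology below. *)
definition vague_topology :: "'a::polish_space measure topology" where
  "vague_topology = topology_generated_by
     {{\<mu> \<in> radon_measures. (\<integral>x. f x \<partial>\<mu>) \<in> U} | f U. f \<in> vague_test_functions \<and> open U}"

(* The Borel sigma-field of the vague topology (which is also the one generated by the
   evaluations \<mu> \<mapsto> \<mu>(B)), traced on the point measures. *)
definition point_measure_space :: "'a::polish_space measure measure" where
  "point_measure_space =
     restrict_space (sigma radon_measures {U. openin vague_topology U}) point_measures"

definition radon_kernel :: "('a::polish_space measure \<Rightarrow> 'a measure) \<Rightarrow> bool" where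
  "radon_kernel \<pi> \<longleftrightarrow>
     (\<forall>\<mu>\<in>point_measures. \<pi> \<mu> \<in> radon_measures) \<and>
     (\<forall>B\<in>sets borel. (\<lambda>\<mu>. emeasure (\<pi> \<mu>) B) \<in> borel_measurable point_measure_space)"

definition vaguely_continuous :: "('a::polish_space measure \<Rightarrow> 'a measure) \<Rightarrow> bool" where
  "vaguely_continuous \<pi> \<longleftrightarrow>
     continuous_map (subtopology vague_topology point_measures) vague_topology \<pi>"

definition add_measure :: "'a measure \<Rightarrow> 'a measure \<Rightarrow> 'a measure" where
  "add_measure \<mu> \<nu> = measure_of (space \<mu>) (sets \<mu>) (\<lambda>A. emeasure \<mu> A + emeasure \<nu> A)"

abbreviation dirac :: "'a::topological_space \<Rightarrow> 'a measure" where
  "dirac x \<equiv> return borel x"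

definition measure_support :: "'a::topological_space measure \<Rightarrow> 'a set" where
  "measure_support \<mu> = {x. \<forall>U. open U \<and> x \<in> U \<longrightarrow> emeasure \<mu> U > 0}"

(* \<pi>(\<mu>,.) = \<rho> + (sum over x in supp \<mu> of c_x(\<mu>{x}) dirac_x) for all point measures \<mu>.
   As c may take negative values, the right-hand side is a signed Radon measure, i.e. a
   real-valued set function on the ring of bounded Borel sets; on an unbounded set it could
   be of the form \<infinity> - \<infinity>.  The sums are finite, see finite_measure_support_Int. *)
definition kernel_representation ::
  "('a::polish_space measure \<Rightarrow> 'a measure) \<Rightarrow> 'a measure \<Rightarrow> ('a \<Rightarrow> nat \<Rightarrow> real) \<Rightarrow> bool" where
  "kernel_representation \<pi> \<rho> c \<longleftrightarrow>
     (\<forall>\<mu>\<in>point_measures. \<forall>B\<in>sets borel. bounded B \<longrightarrow>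
        measure (\<pi> \<mu>) B =
          measure \<rho> B + (\<Sum>x\<in>measure_support \<mu> \<inter> B. c x (nat \<lfloor>measure \<mu> {x}\<rfloor>)))"

(* \<pi>(n dirac_x, {x}) - \<pi>((n-1) dirac_x, {x}), for n \<ge> 1.  This is the density of c_x with
   respect to counting measure on {1,2,...}: c_x(n) is the sum of these increments over
   1,...,n.  It is in general not c_x(n) itself: the Polya kernel \<pi>(\<mu>,.) = \<rho> + \<mu> has
   c_x(n) = n and all increments equal to 1. *)
definition kernel_increment ::
  "('a::polish_space measure \<Rightarrow> 'a measure) \<Rightarrow> 'a \<Rightarrow> nat \<Rightarrow> real" where
  "kernel_increment \<pi> x n =
     measure (\<pi> (scale_measure (of_nat n) (dirac x))) {x}
     - measure (\<pi> (scale_measure (of_nat (n - 1)) (dirac x))) {x}"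

lemma space_add_measure [simp]: "space (add_measure \<mu> \<nu>) = space \<mu>"
  by (simp add: add_measure_def)

lemma sets_add_measure [simp]: "sets (add_measure \<mu> \<nu>) = sets \<mu>"
  by (simp add: add_measure_def)

lemma emeasure_add_measure:
  assumes "sets \<nu> = sets \<mu>" "A \<in> sets \<mu>"
  shows "emeasure (add_measure \<mu> \<nu>) A = emeasure \<mu> A + emeasure \<nu> A"
proof (rule emeasure_measure_of[OF add_measure_def])
  show "countably_additive (sets (add_measure \<mu> \<nu>)) (\<lambda>A. emeasure \<mu> A + emeasure \<nu> A)"
    by (auto simp: countably_additive_def assms(1) suminf_emeasure subset_eq
             suminf_add[symmetric])
qed (use assms sets.space_closed in \<open>auto simp: positive_def\<close>)

lemma limitin_vague_topology:
  assumes "\<And>k. \<mu> k \<in> radon_measures" "\<nu> \<in> radon_measures"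
  shows "limitin vague_topology \<mu> \<nu> sequentially \<longleftrightarrow>
    (\<forall>f\<in>vague_test_functions. (\<lambda>k. \<integral>x. f x \<partial>\<mu> k) \<longlonglongrightarrow> (\<integral>x. f x \<partial>\<nu>))"
  (is "?L \<longleftrightarrow> ?R")
proof
  assume L: ?L
  show ?R
  proof (intro ballI topological_tendstoI)
    fix f :: "'a \<Rightarrow> real" and U :: "real set"
    assume f: "f \<in> vague_test_functions" and U: "open U" "(\<integral>x. f x \<partial>\<nu>) \<in> U"
    have "openin vague_topology {\<mu> \<in> radon_measures. (\<integral>x. f x \<partial>\<mu>) \<in> U}"
      unfolding vague_topology_def by (rule topology_generated_by_Basis) (use f U in blast)
    then have "\<forall>\<^sub>F k in sequentially. \<mu> k \<in> {\<mu> \<in> radon_measures. (\<integral>x. f x \<partial>\<mu>) \<in> U}"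
      using L U assms by (auto simp: limitin_def)
    then show "\<forall>\<^sub>F k in sequentially. (\<integral>x. f x \<partial>\<mu> k) \<in> U"
      by (rule eventually_mono) auto
  qed
next
  assume R: ?R
  have zero: "(\<lambda>_. 0) \<in> vague_test_functions"
    by (auto simp: vague_test_functions_def)
  have "generate_topology_on
      {{\<mu> \<in> radon_measures. (\<integral>x. f x \<partial>\<mu>) \<in> U} | f U. f \<in> vague_test_functions \<and> open U} V
      \<Longrightarrow> \<nu> \<in> V \<Longrightarrow> \<forall>\<^sub>F k in sequentially. \<mu> k \<in> V" for V
  proof (induction V rule: generate_topology_on.induct)
    case (Int a b)
    then show ?case by (auto intro: eventually_conj)
  next
    case (UN K)
    then obtain k where k: "k \<in> K" "\<nu> \<in> k" by blast
    then have "\<forall>\<^sub>F i in sequentially. \<mu> i \<in> k" using UN by blast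
    then show ?case by (rule eventually_mono) (use k in blast)
  next
    case (Basis s)
    then obtain f U where fU: "f \<in> vague_test_functions" "open U"
      "s = {\<mu> \<in> radon_measures. (\<integral>x. f x \<partial>\<mu>) \<in> U}" by blast
    then have "\<forall>\<^sub>F k in sequentially. (\<integral>x. f x \<partial>\<mu> k) \<in> U"
      using R Basis by (auto intro: topological_tendstoD)
    then show ?case using assms fU by simp
  qed auto
  moreover have "\<nu> \<in> topspace vague_topology"
    unfolding vague_topology_def topology_generated_by_topspace
    using zero assms(2) by (intro UnionI[of radon_measures]) (auto intro!: exI[of _ UNIV])
  ultimately show ?L
    by (auto simp: limitin_def vague_topology_def openin_topology_generated_by_iff)
qed

lemma finite_measure_support_Int:
  fixes \<mu> :: "'a::polish_space measure"
  assumes \<mu>: "\<mu> \<in> point_measures" and B: "bounded B"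
  shows "finite (measure_support \<mu> \<inter> B)"
proof -
  have sets: "sets \<mu> = sets borel" using \<mu> by (auto simp: point_measures_def radon_measures_def)
  obtain a r where ar: "B \<subseteq> ball a r" by (metis B bounded_subset_ballD)
  have "emeasure \<mu> (ball a r) < \<infinity>"
    using \<mu> by (auto simp: point_measures_def radon_measures_def)
  moreover have "emeasure \<mu> (ball a r) \<in> range of_nat \<union> {\<infinity>}"
    using \<mu> by (auto simp: point_measures_def)
  ultimately obtain N :: nat where N: "emeasure \<mu> (ball a r) = of_nat N" by auto
  have "card F \<le> N" if F: "finite F" "F \<subseteq> measure_support \<mu> \<inter> B" for F
  proof -
    obtain d where d: "d > 0" "\<And>x y. x \<in> F \<Longrightarrow> y \<in> F \<Longrightarrow> x \<noteq> y \<Longrightarrow> d \<le> dist x y"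
    proof
      define D where "D = insert 1 ((\<lambda>(x, y). dist x y) ` ((F \<times> F) - Id))"
      have "finite D" unfolding D_def using F(1) by (intro finite.insertI finite_imageI) auto
      then show "Min D > 0" "\<And>x y. x \<in> F \<Longrightarrow> y \<in> F \<Longrightarrow> x \<noteq> y \<Longrightarrow> Min D \<le> dist x y"
        by (auto simp: D_def intro!: Min_le)
    qed
    define A where "A x = ball x (d/2) \<inter> ball a r" for x
    have disj: "disjoint_family_on A F"
      unfolding disjoint_family_on_def
    proof (intro ballI impI)
      fix x y assume xy: "x \<in> F" "y \<in> F" "x \<noteq> y"
      have "dist x y < d" if "z \<in> A x" "z \<in> A y" for z
        using that dist_triangle2[of x y z] by (auto simp: A_def)
      then show "A x \<inter> A y = {}" using d(2)[OF xy] by fastforce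
    qed
    have ge1: "1 \<le> emeasure \<mu> (A x)" if "x \<in> F" for x
    proof -
      have "0 < emeasure \<mu> (A x)"
      proof -
        have "x \<in> measure_support \<mu>" "open (A x)" "x \<in> A x"
          using that F(2) ar d(1) by (auto simp: A_def)
        then show ?thesis unfolding measure_support_def by blast
      qed
      moreover have "emeasure \<mu> (A x) \<in> range of_nat \<union> {\<infinity>}"
        using \<mu> by (auto simp: point_measures_def A_def)
      ultimately show ?thesis by auto
    qed
    have "of_nat (card F) = (\<Sum>x\<in>F. 1::ennreal)" by simp
    also have "\<dots> \<le> (\<Sum>x\<in>F. emeasure \<mu> (A x))" by (intro sum_mono ge1)
    also have "\<dots> = emeasure \<mu> (\<Union>x\<in>F. A x)"
      by (rule sum_emeasure[OF _ disj F(1)]) (auto simp: sets A_def)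
    also have "\<dots> \<le> of_nat N"
      unfolding N[symmetric] by (rule emeasure_mono) (auto simp: sets A_def)
    finally show ?thesis by simp
  qed
  then show ?thesis by (meson finite_if_finite_subsets_card_bdd)
qed

end

theory Submission
  imports Defs
begin

text \<open>
  By locality, adding finitely many atoms to a point measure changes the kernel only at those
  atoms, and at an atom only through its own multiplicity; this is the formula for finite point
  measures. A general point measure is the vague limit of its restrictions to the balls of radius
  \<open>k\<close>. Along this sequence the kernel is eventually constant on every bounded set,
  so by vague continuity the kernel of the limit has that same constant value.
\<close>

section \<open>Radon measures, point measures and their restrictions\<close>

lemma emeasure_bounded_finite:
  assumes "\<mu> \<in> radon_measures" "B \<in> sets borel" "bounded B"
  shows "emeasure \<mu> B \<noteq> \<infinity>"
  using assms by (auto simp: radon_measures_def)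

lemma sets_radon_measure: "\<mu> \<in> radon_measures \<Longrightarrow> sets \<mu> = sets borel"
  by (simp add: radon_measures_def)

lemma space_radon_measure: "\<mu> \<in> radon_measures \<Longrightarrow> space \<mu> = UNIV"
  using sets_eq_imp_space_eq[OF sets_radon_measure] by simp

lemma point_measure_radon: "\<mu> \<in> point_measures \<Longrightarrow> \<mu> \<in> radon_measures"
  by (simp add: point_measures_def)

text \<open>A singleton is bounded, so its mass is finite and hence a natural number: rounding loses
  nothing. The rounded form is the argument of \<open>c\<close> in
  \<open>kernel_representation\<close>.\<close>

lemma point_measure_singleton:
  assumes "\<mu> \<in> point_measures"
  shows "emeasure \<mu> {x} = of_nat (nat \<lfloor>measure \<mu> {x}\<rfloor>)"
proof -
  have "emeasure \<mu> {x} \<noteq> \<infinity>"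
    using emeasure_bounded_finite[OF point_measure_radon[OF assms], of "{x}"] by simp
  moreover have "emeasure \<mu> {x} \<in> range of_nat \<union> {\<infinity>}"
    using assms by (simp add: point_measures_def)
  ultimately obtain n :: nat where "emeasure \<mu> {x} = of_nat n" by auto
  then show ?thesis by (simp add: measure_def)
qed

text \<open>Encoded as a density rather than by \<open>restrict_space\<close>, so that the result
  still lives on the whole Borel space and can be an argument of \<pi>.\<close>

definition restrict_mass :: "'a::polish_space measure \<Rightarrow> 'a set \<Rightarrow> 'a measure" where
  "restrict_mass \<mu> T = density \<mu> (indicator T)"

lemma sets_restrict_mass [simp]: "sets (restrict_mass \<mu> T) = sets \<mu>"
  by (simp add: restrict_mass_def)

lemma emeasure_restrict_mass:
  assumes "\<mu> \<in> radon_measures" "T \<in> sets borel" "B \<in> sets borel"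
  shows "emeasure (restrict_mass \<mu> T) B = emeasure \<mu> (T \<inter> B)"
  unfolding restrict_mass_def
  by (rule emeasure_restricted) (use assms in \<open>simp_all add: sets_radon_measure\<close>)

lemma restrict_mass_radon:
  assumes "\<mu> \<in> radon_measures" "T \<in> sets borel"
  shows "restrict_mass \<mu> T \<in> radon_measures"
  using assms emeasure_bounded_finite[OF assms(1)]
  by (auto simp: radon_measures_def emeasure_restrict_mass less_top)

lemma restrict_mass_point:
  assumes "\<mu> \<in> point_measures" "T \<in> sets borel"
  shows "restrict_mass \<mu> T \<in> point_measures"
  using assms restrict_mass_radon[OF point_measure_radon[OF assms(1)] assms(2)]
  by (simp add: point_measures_def emeasure_restrict_mass)

lemma point_measures_add_dirac:
  assumes "\<mu> \<in> point_measures"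
  shows "add_measure \<mu> (scale_measure (of_nat n) (dirac y)) \<in> point_measures"
proof -
  have s: "sets \<mu> = sets borel" using assms by (simp add: point_measures_def radon_measures_def)
  have e: "emeasure (add_measure \<mu> (scale_measure (of_nat n) (dirac y))) B
      = emeasure \<mu> B + of_nat n * indicator B y" if "B \<in> sets borel" for B
    using that s by (simp add: emeasure_add_measure)
  have "emeasure \<mu> B + of_nat n * indicator B y \<in> range of_nat \<union> {\<infinity>}"
    if "B \<in> sets borel" for B
  proof -
    from that assms consider m :: nat where "emeasure \<mu> B = of_nat m" | "emeasure \<mu> B = \<infinity>"
      by (fastforce simp: point_measures_def)
    then show ?thesis
    proof cases
      case 1
      then have "emeasure \<mu> B + of_nat n * indicator B y = of_nat (m + n * indicator B y)"
        by (simp add: indicator_def)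
      then show ?thesis by blast
    qed simp
  qed
  moreover have "emeasure \<mu> B + of_nat n * indicator B y < \<infinity>"
    if "B \<in> sets borel" "bounded B" for B
    using emeasure_bounded_finite[OF point_measure_radon[OF assms] that]
    by (simp add: indicator_def less_top of_nat_less_top)
  ultimately show ?thesis
    using s e by (simp add: point_measures_def radon_measures_def)
qed

lemma null_measure_point: "null_measure borel \<in> point_measures"
  by (auto simp: point_measures_def radon_measures_def intro: range_eqI[of _ _ 0])

lemma add_null_measure:
  assumes "sets \<nu> = sets borel"
  shows "add_measure (null_measure borel) \<nu> = \<nu>"
  by (rule measure_eqI) (use assms in \<open>simp_all add: emeasure_add_measure\<close>)

lemma scale_dirac_point: "scale_measure (of_nat n) (dirac x) \<in> point_measures"
  using point_measures_add_dirac[OF null_measure_point, of n x]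
  by (simp add: add_null_measure)

text \<open>The induction step for adjoining atoms one at a time. The multiplicity may be 0, so
  \<open>y\<close> need not be an atom of \<mu>.\<close>

lemma restrict_mass_insert:
  assumes \<mu>: "\<mu> \<in> point_measures" and T: "T \<in> sets borel" "y \<notin> T"
  shows "restrict_mass \<mu> (insert y T) =
    add_measure (restrict_mass \<mu> T) (scale_measure (of_nat (nat \<lfloor>measure \<mu> {y}\<rfloor>)) (dirac y))"
proof (rule measure_eqI)
  note r = point_measure_radon[OF \<mu>] and s = sets_radon_measure[OF point_measure_radon[OF \<mu>]]
  fix A assume "A \<in> sets (restrict_mass \<mu> (insert y T))"
  then have A: "A \<in> sets borel" using s by simp
  have "emeasure \<mu> (insert y T \<inter> A) = emeasure \<mu> (T \<inter> A) + emeasure \<mu> {y} * indicator A y"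
  proof (cases "y \<in> A")
    case True
    have "emeasure \<mu> ((T \<inter> A) \<union> {y}) = emeasure \<mu> (T \<inter> A) + emeasure \<mu> {y}"
      by (rule plus_emeasure[symmetric]) (use A T s in auto)
    moreover have "insert y T \<inter> A = (T \<inter> A) \<union> {y}" using True by auto
    ultimately show ?thesis using True by simp
  qed simp
  then show "emeasure (restrict_mass \<mu> (insert y T)) A =
      emeasure (add_measure (restrict_mass \<mu> T)
        (scale_measure (of_nat (nat \<lfloor>measure \<mu> {y}\<rfloor>)) (dirac y))) A"
    unfolding point_measure_singleton[OF \<mu>, symmetric]
    using A T s by (simp add: emeasure_add_measure emeasure_restrict_mass r)
qed simp

section \<open>Locality and finite sets of atoms\<close>

text \<open>Hypothesis (ii) of the theorem, with the inclusion in the complement of \<open>y\<close>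
  replaced by \<open>y \<notin> B\<close>.\<close>

definition local_kernel :: "('a::polish_space measure \<Rightarrow> 'a measure) \<Rightarrow> bool" where
  "local_kernel \<pi> \<longleftrightarrow> (\<forall>y. \<forall>\<mu>\<in>point_measures. \<forall>B\<in>sets borel. y \<notin> B \<longrightarrow>
      emeasure (\<pi> (add_measure \<mu> (dirac y))) B = emeasure (\<pi> \<mu>) B)"

text \<open>The copies of the Dirac measure are added one by one; each intermediate measure is again
  a point measure, so locality applies every time.\<close>

lemma local_kernel_add_diracs:
  assumes loc: "local_kernel \<pi>" and \<mu>: "\<mu> \<in> point_measures" and B: "B \<in> sets borel" "y \<notin> B"
  shows "emeasure (\<pi> (add_measure \<mu> (scale_measure (of_nat n) (dirac y)))) B = emeasure (\<pi> \<mu>) B"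
proof (induction n)
  have s: "sets \<mu> = sets borel" using sets_radon_measure[OF point_measure_radon[OF \<mu>]] .
  {
    case 0
    have "add_measure \<mu> (scale_measure (of_nat 0) (dirac y)) = \<mu>"
      by (rule measure_eqI) (use s in \<open>simp_all add: emeasure_add_measure\<close>)
    then show ?case by simp
  next
    case (Suc n)
    have "add_measure \<mu> (scale_measure (of_nat (Suc n)) (dirac y)) =
        add_measure (add_measure \<mu> (scale_measure (of_nat n) (dirac y))) (dirac y)"
      by (rule measure_eqI) (use s in \<open>simp_all add: emeasure_add_measure distrib_right add_ac\<close>)
    then show ?case
      using Suc loc point_measures_add_dirac[OF \<mu>, of n y] B by (simp add: local_kernel_def)
  }
qed

text \<open>Every point of \<open>F\<close> lies outside \<open>B\<close>, so adjoining the points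
  in turn is invisible on \<open>B\<close>. Read backwards, atoms outside \<open>B\<close> may be
  deleted.\<close>

lemma local_kernel_restrict_mass_Un:
  assumes loc: "local_kernel \<pi>" and \<mu>: "\<mu> \<in> point_measures" and T: "T \<in> sets borel"
    and F: "finite F" and B: "B \<in> sets borel" "F \<inter> B = {}"
  shows "emeasure (\<pi> (restrict_mass \<mu> (T \<union> F))) B = emeasure (\<pi> (restrict_mass \<mu> T)) B"
  using F B(2)
proof (induction F)
  case (insert y F)
  have TF: "T \<union> F \<in> sets borel" using T insert by (auto intro: borel_closed finite_imp_closed)
  have "emeasure (\<pi> (restrict_mass \<mu> (insert y (T \<union> F)))) B = emeasure (\<pi> (restrict_mass \<mu> (T \<union> F))) B"
  \<comment> \<open>\<open>F\<close> may overlap \<open>T\<close>; a point that is already present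
    changes nothing.\<close>
  proof (cases "y \<in> T \<union> F")
    case False
    show ?thesis
      unfolding restrict_mass_insert[OF \<mu> TF False]
      by (rule local_kernel_add_diracs[OF loc restrict_mass_point[OF \<mu> TF] B(1)])
        (use insert in auto)
  qed (simp add: insert_absorb)
  then show ?case using insert by simp
qed simp

lemma restrict_mass_empty:
  assumes "\<mu> \<in> radon_measures"
  shows "restrict_mass \<mu> {} = null_measure borel"
  by (rule measure_eqI) (use assms in \<open>simp_all add: emeasure_restrict_mass sets_radon_measure\<close>)

lemma restrict_mass_singleton:
  assumes "\<mu> \<in> point_measures"
  shows "restrict_mass \<mu> {x} = scale_measure (of_nat (nat \<lfloor>measure \<mu> {x}\<rfloor>)) (dirac x)"
  using restrict_mass_insert[OF assms, of "{}" x]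
  by (simp add: restrict_mass_empty point_measure_radon assms add_null_measure)

text \<open>Boundedness of \<open>B\<close> keeps all masses finite, which makes the real-valued
  \<open>measure\<close> additive here.\<close>

lemma measure_diff_finite_sum:
  assumes \<nu>: "\<nu> \<in> radon_measures" and B: "B \<in> sets borel" "bounded B" and F: "finite F" "F \<subseteq> B"
  shows "measure \<nu> B = measure \<nu> (B - F) + (\<Sum>x\<in>F. measure \<nu> {x})"
proof -
  have fin: "emeasure \<nu> A \<noteq> \<infinity>" if "A \<subseteq> B" "A \<in> sets borel" for A
    using emeasure_bounded_finite[OF \<nu> that(2)] that(1) B(2) bounded_subset by blast
  have Fs: "F \<in> sets borel" using F by (auto intro: borel_closed finite_imp_closed)
  note s = sets_radon_measure[OF \<nu>]
  have "measure \<nu> ((B - F) \<union> F) = measure \<nu> (B - F) + measure \<nu> F"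
    by (rule measure_Union) (use fin F B Fs s in auto)
  moreover have "measure \<nu> F = (\<Sum>x\<in>F. measure \<nu> {x})"
    by (rule measure_eq_sum_singleton) (use fin F s in auto)
  ultimately show ?thesis using F by (simp add: Un_absorb2)
qed

text \<open>The candidate for \<open>c\<close>: the increments summed over 1,...,n, by telescoping.
  It vanishes at \<open>n = 0\<close>.\<close>

definition atom_excess :: "('a::polish_space measure \<Rightarrow> 'a measure) \<Rightarrow> 'a \<Rightarrow> nat \<Rightarrow> real" where
  "atom_excess \<pi> x n = measure (\<pi> (scale_measure (of_nat n) (dirac x))) {x}
     - measure (\<pi> (null_measure borel)) {x}"

text \<open>\<open>B\<close> is split into the points of \<open>F\<close> and the rest, and on each
  piece locality deletes the atoms outside it.\<close>

lemma kernel_restrict_mass_finite: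
  assumes ker: "\<And>\<mu>. \<mu> \<in> point_measures \<Longrightarrow> \<pi> \<mu> \<in> radon_measures"
    and loc: "local_kernel \<pi>" and \<mu>: "\<mu> \<in> point_measures" and F: "finite F"
    and B: "B \<in> sets borel" "bounded B"
  shows "measure (\<pi> (restrict_mass \<mu> F)) B = measure (\<pi> (null_measure borel)) B
    + (\<Sum>x\<in>F \<inter> B. atom_excess \<pi> x (nat \<lfloor>measure \<mu> {x}\<rfloor>))"
proof -
  have Fs: "F \<in> sets borel" using F by (auto intro: borel_closed finite_imp_closed)
  let ?\<nu> = "\<pi> (restrict_mass \<mu> F)" and ?\<rho> = "\<pi> (null_measure borel)"
  have \<nu>: "?\<nu> \<in> radon_measures" and \<rho>: "?\<rho> \<in> radon_measures"
    using ker restrict_mass_point[OF \<mu> Fs] null_measure_point by auto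
  \<comment> \<open>Off \<open>F\<close> all atoms can be deleted, which leaves the zero
    measure.\<close>
  have "F \<inter> (B - F \<inter> B) = {}" by blast
  then have "measure ?\<nu> (B - F \<inter> B) = measure ?\<rho> (B - F \<inter> B)"
    using local_kernel_restrict_mass_Un[OF loc \<mu>, of "{}" F "B - F \<inter> B"] F Fs B
    by (simp add: measure_def restrict_mass_empty point_measure_radon[OF \<mu>])
  \<comment> \<open>At \<open>x\<close> the atoms in \<open>F - {x}\<close> can be deleted, which
    leaves a multiple of the Dirac measure at \<open>x\<close>.\<close>
  moreover have "measure ?\<nu> {x} = measure (\<pi> (scale_measure (of_nat (nat \<lfloor>measure \<mu> {x}\<rfloor>)) (dirac x))) {x}"
    if "x \<in> F" for x
    using local_kernel_restrict_mass_Un[OF loc \<mu>, of "{x}" "F - {x}" "{x}"] F that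
    by (simp add: measure_def restrict_mass_singleton[OF \<mu>] insert_absorb)
  ultimately show ?thesis
    using measure_diff_finite_sum[OF \<nu> B, of "F \<inter> B"] measure_diff_finite_sum[OF \<rho> B, of "F \<inter> B"] F
    by (simp add: atom_excess_def sum_subtractf)
qed

section \<open>Test functions and equality of measures\<close>

text \<open>The integrand vanishes off \<open>S\<close>, so both integrals can be taken over
  \<open>S\<close>, where the two measures coincide.\<close>

lemma vague_test_integral_cong:
  assumes \<mu>: "\<mu> \<in> radon_measures" and \<nu>: "\<nu> \<in> radon_measures" and S: "S \<in> sets borel"
    and eq: "\<And>B. B \<in> sets borel \<Longrightarrow> B \<subseteq> S \<Longrightarrow> emeasure \<mu> B = emeasure \<nu> B"
    and f: "{x. f x \<noteq> (0::real)} \<subseteq> S"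
  shows "(\<integral>x. f x \<partial>\<mu>) = (\<integral>x. f x \<partial>\<nu>)"
proof -
  note s = sets_radon_measure[OF \<mu>] sets_radon_measure[OF \<nu>]
  note sp = space_radon_measure[OF \<mu>] space_radon_measure[OF \<nu>]
  have "restrict_space \<mu> S = restrict_space \<nu> S"
  proof (rule measure_eqI)
    show "sets (restrict_space \<mu> S) = sets (restrict_space \<nu> S)"
      using s by (simp add: sets_restrict_space)
    fix A assume "A \<in> sets (restrict_space \<mu> S)"
    then have A: "A \<subseteq> S" "A \<in> sets borel" using S s by (auto simp: sets_restrict_space)
    then show "emeasure (restrict_space \<mu> S) A = emeasure (restrict_space \<nu> S) A"
      using S s sp eq by (simp add: emeasure_restrict_space)
  qed
  moreover have "(\<integral>x. f x \<partial>M) = (\<integral>x. f x \<partial>restrict_space M S)"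
    if "sets M = sets borel" "space M = UNIV" for M
  proof -
    have "indicator S x *\<^sub>R f x = f x" for x using f by (auto simp: indicator_def)
    then have "(\<integral>x. indicator S x *\<^sub>R f x \<partial>M) = (\<integral>x. f x \<partial>M)" by (simp only:)
    then show ?thesis using that S by (simp add: integral_restrict_space)
  qed
  ultimately show ?thesis using s sp by simp
qed

text \<open>Indicators of open subsets of \<open>U\<close> are limits of test functions supported in
  \<open>U\<close>, and the open sets form a generator stable under intersection.\<close>

lemma emeasure_eq_if_vague_tests_eq:
  assumes \<mu>: "\<mu> \<in> radon_measures" and \<nu>: "\<nu> \<in> radon_measures" and U: "open U" "bounded U"
    and eq: "\<And>f. f \<in> vague_test_functions \<Longrightarrow> {x. f x \<noteq> 0} \<subseteq> U \<Longrightarrow> (\<integral>x. f x \<partial>\<mu>) = (\<integral>x. f x \<partial>\<nu>)"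
    and B: "B \<in> sets borel" "B \<subseteq> U"
  shows "emeasure \<mu> B = emeasure \<nu> B"
proof -
  have "emeasure \<mu> V = emeasure \<nu> V" if V: "open V" "V \<subseteq> U" for V
  proof -
    \<comment> \<open>Continuous approximations of the indicator of \<open>V\<close> from below. The
      case \<open>V = UNIV\<close> is separate because \<open>infdist\<close> to the empty set is 0
      by convention.\<close>
    define f where "f k x = (if V = UNIV then 1 else min 1 (real k * infdist x (- V)))" for k x
    have f_cont: "continuous_on UNIV (f k)" for k
      unfolding f_def by (cases "V = UNIV") (auto intro!: continuous_intros)
    have f01: "0 \<le> f k x" "f k x \<le> 1" for k x by (auto simp: f_def infdist_nonneg)
    have f0: "f k x = 0" if "x \<notin> V" for k x using that by (auto simp: f_def)
    have bV: "bounded V" using U(2) V(2) bounded_subset by blast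
    have ft: "f k \<in> vague_test_functions" for k
      unfolding vague_test_functions_def
    proof (intro CollectI conjI f_cont)
      show "bounded (range (f k))" using f01 by (auto simp: bounded_iff intro!: exI[of _ 1])
      show "bounded {x. f k x \<noteq> 0}" using f0 by (intro bounded_subset[OF bV]) auto
    qed
    have lim: "(\<lambda>k. f k x) \<longlonglongrightarrow> indicator V x" for x
    proof (cases "x \<in> V \<and> V \<noteq> UNIV")
      case True
      have "infdist x (- V) \<noteq> 0"
        using True V(1) in_closed_iff_infdist_zero[of "- V" x] by (auto simp: closed_Compl)
      then have pos: "infdist x (- V) > 0" using infdist_nonneg[of x "- V"] by simp
      \<comment> \<open>Past the reciprocal of the distance to the complement the minimum in
        \<open>f\<close> is attained by 1.\<close>
      obtain N :: nat where N: "1 / infdist x (- V) \<le> real N" using real_arch_simple by blast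
      have "f k x = 1" if "k \<ge> N" for k
      proof -
        have "1 / infdist x (- V) \<le> real k" using N that by linarith
        then show ?thesis using pos True by (auto simp: f_def field_simps)
      qed
      then have "\<forall>\<^sub>F k in sequentially. f k x = 1" by (auto simp: eventually_sequentially)
      then show ?thesis using True by (simp add: tendsto_eventually)
    next
      case False
      then show ?thesis using f0 by (cases "V = UNIV") (auto simp: f_def[abs_def])
    qed
    have conv: "(\<lambda>k. \<integral>x. f k x \<partial>M) \<longlonglongrightarrow> measure M V" if M: "M \<in> radon_measures" for M
    proof -
      note s = sets_radon_measure[OF M]
      \<comment> \<open>The indicator of \<open>V\<close> dominates, and it is integrable because
        \<open>V\<close> is bounded.\<close>
      have "(\<lambda>k. \<integral>x. f k x \<partial>M) \<longlonglongrightarrow> (\<integral>x. indicator V x \<partial>M)"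
      proof (rule integral_dominated_convergence[where w = "indicator V"])
        show "integrable M (indicator V :: 'a \<Rightarrow> real)"
          using V(1) s emeasure_bounded_finite[OF M _ bV] by (simp add: less_top)
        show "AE x in M. (\<lambda>k. f k x) \<longlonglongrightarrow> indicator V x" using lim by simp
        show "AE x in M. norm (f k x) \<le> indicator V x" for k
          using f01[of k] f0[of _ k] by (auto simp: indicator_def)
        show "f k \<in> borel_measurable M" for k
          using borel_measurable_continuous_onI[OF f_cont[of k]] s
          by (simp cong: measurable_cong_sets)
      qed (use V(1) s in \<open>intro borel_measurable_indicator, simp\<close>)
      then show ?thesis using space_radon_measure[OF M] by simp
    qed
    have "{x. f k x \<noteq> 0} \<subseteq> U" for k using f0 V(2) by blast
    then have "(\<integral>x. f k x \<partial>\<mu>) = (\<integral>x. f k x \<partial>\<nu>)" for k using eq ft by blast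
    then have "measure \<mu> V = measure \<nu> V"
      using conv[OF \<mu>] conv[OF \<nu>] LIMSEQ_unique by fastforce
    then show ?thesis
      using emeasure_bounded_finite[OF \<mu> _ bV] emeasure_bounded_finite[OF \<nu> _ bV] V(1)
      by (simp add: emeasure_eq_ennreal_measure)
  qed
  note eq_open = this
  have Us: "U \<in> sets borel" using U by simp
  \<comment> \<open>Restriction to the bounded set \<open>U\<close> makes both measures finite, so
    the constant sequence \<open>UNIV\<close> serves as the exhaustion.\<close>
  have "restrict_mass \<mu> U = restrict_mass \<nu> U"
  proof (rule measure_eqI_generator_eq[where E = "{S. open S}" and \<Omega> = UNIV and A = "\<lambda>_. UNIV"])
    show "Int_stable {S :: 'a set. open S}" by (auto simp: Int_stable_def)
    show "emeasure (restrict_mass \<mu> U) X = emeasure (restrict_mass \<nu> U) X" if "X \<in> {S. open S}" for X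
      using that eq_open[of "U \<inter> X"] U by (simp add: emeasure_restrict_mass \<mu> \<nu> open_Int)
    show "emeasure (restrict_mass \<mu> U) UNIV \<noteq> \<infinity>"
      using emeasure_bounded_finite[OF \<mu> Us U(2)] Us by (simp add: emeasure_restrict_mass \<mu>)
  qed (use sets_radon_measure[OF \<mu>] sets_radon_measure[OF \<nu>] in \<open>auto simp: borel_def\<close>)
  then have "emeasure (restrict_mass \<mu> U) B = emeasure (restrict_mass \<nu> U) B" by simp
  then show ?thesis using B Us by (simp add: emeasure_restrict_mass \<mu> \<nu> Int_absorb1)
qed

text \<open>Balls exhaust the space, and continuity from below extends the equality from bounded
  sets to all Borel sets. This suits \<open>kernel_representation\<close>, which only speaks of
  bounded sets.\<close>

lemma radon_measure_eqI:
  assumes \<mu>: "\<mu> \<in> radon_measures" and \<nu>: "\<nu> \<in> radon_measures"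
    and eq: "\<And>B. B \<in> sets borel \<Longrightarrow> bounded B \<Longrightarrow> measure \<mu> B = measure \<nu> B"
  shows "\<mu> = \<nu>"
proof (rule measure_eqI)
  fix B assume "B \<in> sets \<mu>"
  then have B: "B \<in> sets borel" using sets_radon_measure[OF \<mu>] by simp
  \<comment> \<open>The centre \<open>undefined\<close> stands for an arbitrary point.\<close>
  define A where "A n = B \<inter> ball undefined (real n)" for n
  have A: "A n \<in> sets borel" "bounded (A n)" for n
    using B by (auto simp: A_def intro: bounded_subset[OF bounded_ball])
  have inc: "incseq A" unfolding A_def incseq_def by auto
  have un: "(\<Union>n. A n) = B" by (auto simp: A_def) (meson reals_Archimedean2)
  have e: "emeasure \<mu> (A n) = emeasure \<nu> (A n)" for n
    using eq[OF A] emeasure_bounded_finite[OF \<mu> A] emeasure_bounded_finite[OF \<nu> A]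
    by (simp add: emeasure_eq_ennreal_measure)
  have sup: "(SUP n. emeasure M (A n)) = emeasure M B" if "M \<in> radon_measures" for M
    using SUP_emeasure_incseq[OF _ inc, of M] A(1) sets_radon_measure[OF that]
    unfolding un by (simp add: image_subset_iff)
  then show "emeasure \<mu> B = emeasure \<nu> B" using sup[OF \<mu>] sup[OF \<nu>] unfolding e by simp
qed (use sets_radon_measure[OF \<mu>] sets_radon_measure[OF \<nu>] in simp)

section \<open>Supports and the limit over growing balls\<close>

text \<open>The complement of the support is the union of all open null sets; by Lindelof countably
  many of them suffice, so this union is null.\<close>

lemma measure_support_props:
  fixes \<mu> :: "'a::polish_space measure"
  assumes s: "sets \<mu> = sets borel"
  shows closed_measure_support: "closed (measure_support \<mu>)"
    and emeasure_Compl_support: "emeasure \<mu> (- measure_support \<mu>) = 0"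
proof -
  define \<U> where "\<U> = {U. open U \<and> emeasure \<mu> U = 0}"
  have eq: "- measure_support \<mu> = \<Union>\<U>"
    by (auto simp: \<U>_def measure_support_def zero_less_iff_neq_zero)
  then have "open (- measure_support \<mu>)" by (auto simp: \<U>_def)
  then show "closed (measure_support \<mu>)" by (simp add: closed_def)
  obtain \<V> where \<V>: "\<V> \<subseteq> \<U>" "countable \<V>" "\<Union>\<V> = \<Union>\<U>"
    by (rule Lindelof[of \<U>]) (auto simp: \<U>_def)
  have "\<Union>\<V> \<in> null_sets \<mu>"
    using \<V>(1,2) s by (intro null_sets_UN'[of \<V> "\<lambda>x. x", simplified]) (auto simp: \<U>_def null_sets_def)
  then show "emeasure \<mu> (- measure_support \<mu>) = 0" using eq \<V>(3) by auto
qed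

lemma emeasure_Int_support:
  fixes \<mu> :: "'a::polish_space measure"
  assumes "sets \<mu> = sets borel" "B \<in> sets borel"
  shows "emeasure \<mu> (measure_support \<mu> \<inter> B) = emeasure \<mu> B"
proof -
  have "- measure_support \<mu> \<in> null_sets \<mu>"
    using emeasure_Compl_support[OF assms(1)] closed_measure_support[OF assms(1)] assms(1)
    by (auto simp: null_sets_def)
  then have "emeasure \<mu> (B - (- measure_support \<mu>)) = emeasure \<mu> B"
    using assms by (intro emeasure_Diff_null_set) auto
  then show ?thesis by (simp add: Diff_Compl Int_commute)
qed

lemma kernel_representation_atom_excess:
  fixes \<pi> :: "'a::polish_space measure \<Rightarrow> 'a measure"
  assumes ker: "\<And>\<mu>. \<mu> \<in> point_measures \<Longrightarrow> \<pi> \<mu> \<in> radon_measures"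
    and loc: "local_kernel \<pi>" and cont: "vaguely_continuous \<pi>"
  shows "kernel_representation \<pi> (\<pi> (null_measure borel)) (atom_excess \<pi>)"
  unfolding kernel_representation_def
proof (intro ballI impI)
  fix \<mu> :: "'a measure" and B :: "'a set"
  assume \<mu>: "\<mu> \<in> point_measures" and B: "B \<in> sets borel" "bounded B"
  note r = point_measure_radon[OF \<mu>] and s = sets_radon_measure[OF point_measure_radon[OF \<mu>]]
  define a :: 'a where "a = undefined"
  \<comment> \<open>Cutting the support rather than the whole space to a ball gives finite sets, to
    which \<open>kernel_restrict_mass_finite\<close> applies.\<close>
  define T where "T k = measure_support \<mu> \<inter> ball a (real k)" for k
  have finT: "finite (T k)" for k
    unfolding T_def by (rule finite_measure_support_Int[OF \<mu> bounded_ball])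
  have Ts: "T k \<in> sets borel" for k using finT by (auto intro: borel_closed finite_imp_closed)
  note point = restrict_mass_point[OF \<mu> Ts]
  have mono: "ball a (real m) \<subseteq> ball a (real k)" if "m \<le> k" for m k
    using that by auto
  have bdd: "\<exists>m. S \<subseteq> ball a (real m)" if S: "bounded S" for S
  proof -
    obtain e where "S \<subseteq> ball a e" using bounded_subset_ballD[OF S] by blast
    moreover obtain m :: nat where "e \<le> real m" using real_arch_simple by blast
    ultimately show ?thesis by (intro exI[of _ m]) auto
  qed
  \<comment> \<open>A test function supported in the ball of radius \<open>m\<close> does not see
    the atoms cut away once \<open>k \<ge> m\<close>, so its integrals are eventually
    constant.\<close>
  have "limitin vague_topology (\<lambda>k. restrict_mass \<mu> (T k)) \<mu> sequentially"
    unfolding limitin_vague_topology[OF point_measure_radon[OF point] r]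
  proof
    fix f :: "'a \<Rightarrow> real" assume f: "f \<in> vague_test_functions"
    obtain m where m: "{x. f x \<noteq> 0} \<subseteq> ball a (real m)"
      using bdd f by (auto simp: vague_test_functions_def)
    have "(\<integral>x. f x \<partial>restrict_mass \<mu> (T k)) = (\<integral>x. f x \<partial>\<mu>)" if k: "k \<ge> m" for k
    proof (rule vague_test_integral_cong[OF point_measure_radon[OF point] r _ _ m])
      fix A assume A: "A \<in> sets borel" "A \<subseteq> ball a (real m)"
      have "T k \<inter> A = measure_support \<mu> \<inter> A" using A mono[OF k] by (auto simp: T_def)
      then show "emeasure (restrict_mass \<mu> (T k)) A = emeasure \<mu> A"
        using A Ts by (simp add: emeasure_restrict_mass r emeasure_Int_support s)
    qed simp
    then show "(\<lambda>k. \<integral>x. f x \<partial>restrict_mass \<mu> (T k)) \<longlonglongrightarrow> (\<integral>x. f x \<partial>\<mu>)"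
      by (intro tendsto_eventually) (auto simp: eventually_sequentially)
  qed
  then have "limitin (subtopology vague_topology point_measures) (\<lambda>k. restrict_mass \<mu> (T k)) \<mu> sequentially"
    using \<mu> point by (simp add: limitin_subtopology)
  \<comment> \<open>Vague continuity carries the convergence over to the kernels.\<close>
  then have "limitin vague_topology (\<pi> \<circ> (\<lambda>k. restrict_mass \<mu> (T k))) (\<pi> \<mu>) sequentially"
    using cont unfolding vaguely_continuous_def by (rule continuous_map_limit[rotated])
  then have lim: "(\<lambda>k. \<integral>x. f x \<partial>\<pi> (restrict_mass \<mu> (T k))) \<longlonglongrightarrow> (\<integral>x. f x \<partial>\<pi> \<mu>)"
    if "f \<in> vague_test_functions" for f
    using that limitin_vague_topology[of "\<lambda>k. \<pi> (restrict_mass \<mu> (T k))" "\<pi> \<mu>"] ker point \<mu>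
    by (simp add: comp_def)
  obtain m where m: "B \<subseteq> ball a (real m)" using bdd B by blast
  have "emeasure (\<pi> \<mu>) B = emeasure (\<pi> (restrict_mass \<mu> (T m))) B"
  proof (rule emeasure_eq_if_vague_tests_eq[OF ker[OF \<mu>] ker[OF point] open_ball bounded_ball _ B(1) m])
    fix f :: "'a \<Rightarrow> real"
    assume f: "f \<in> vague_test_functions" "{x. f x \<noteq> 0} \<subseteq> ball a (real m)"
    \<comment> \<open>The atoms in \<open>T k - T m\<close> lie outside the ball of radius
      \<open>m\<close>, so by locality they leave the kernel unchanged inside it.\<close>
    have stable: "(\<integral>x. f x \<partial>\<pi> (restrict_mass \<mu> (T k))) = (\<integral>x. f x \<partial>\<pi> (restrict_mass \<mu> (T m)))"
      if k: "k \<ge> m" for k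
    proof (rule vague_test_integral_cong[OF ker[OF point] ker[OF point] _ _ f(2)])
      fix A assume A: "A \<in> sets borel" "A \<subseteq> ball a (real m)"
      have T: "T m \<union> (T k - T m) = T k" "(T k - T m) \<inter> A = {}"
        using mono[OF k] A by (auto simp: T_def)
      show "emeasure (\<pi> (restrict_mass \<mu> (T k))) A = emeasure (\<pi> (restrict_mass \<mu> (T m))) A"
        using local_kernel_restrict_mass_Un[OF loc \<mu> Ts[of m] finite_Diff[OF finT[of k]] A(1) T(2)]
        unfolding T(1) .
    qed simp
    have "(\<lambda>k. \<integral>x. f x \<partial>\<pi> (restrict_mass \<mu> (T k))) \<longlonglongrightarrow> (\<integral>x. f x \<partial>\<pi> (restrict_mass \<mu> (T m)))"
      by (intro tendsto_eventually eventually_sequentiallyI[of m] stable)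
    with lim[OF f(1)] show "(\<integral>x. f x \<partial>\<pi> \<mu>) = (\<integral>x. f x \<partial>\<pi> (restrict_mass \<mu> (T m)))"
      by (rule LIMSEQ_unique)
  qed
  moreover have "T m \<inter> B = measure_support \<mu> \<inter> B" using m by (auto simp: T_def)
  ultimately show "measure (\<pi> \<mu>) B = measure (\<pi> (null_measure borel)) B
      + (\<Sum>x\<in>measure_support \<mu> \<inter> B. atom_excess \<pi> x (nat \<lfloor>measure \<mu> {x}\<rfloor>))"
    using kernel_restrict_mass_finite[OF ker loc \<mu> finT B, of m] by (simp add: measure_def)
qed

section \<open>Measurability of the coefficients\<close>

lemma integral_scale_dirac:
  fixes f :: "'a::polish_space \<Rightarrow> real"
  assumes "f \<in> borel_measurable borel"
  shows "(\<integral>z. f z \<partial>scale_measure (of_nat n) (dirac x)) = real n * f x"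
proof -
  have "scale_measure (of_nat n) (dirac x) = density (dirac x) (\<lambda>_. ennreal (real n))"
    by (rule measure_eqI) (simp_all add: emeasure_density nn_integral_cmult_indicator ennreal_of_nat_eq_real_of_nat)
  then show ?thesis using assms by (simp add: integral_density integral_return)
qed

lemma topspace_vague_subset: "topspace vague_topology \<subseteq> radon_measures"
  unfolding vague_topology_def topology_generated_by_topspace by auto

text \<open>The map is vaguely continuous: the preimage of a subbasic open set is the preimage of
  \<open>U\<close> under the continuous function \<open>real n * f x\<close>.\<close>

lemma measurable_scale_dirac:
  "(\<lambda>x. scale_measure (of_nat n) (dirac x)) \<in> borel \<rightarrow>\<^sub>M (point_measure_space :: 'a::polish_space measure measure)"
  unfolding point_measure_space_def
proof (intro measurable_restrict_space2 measurable_measure_of)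
  show "{U. openin vague_topology U} \<subseteq> Pow radon_measures"
    using topspace_vague_subset openin_subset by fastforce
  show "(\<lambda>x. scale_measure (of_nat n) (dirac x)) \<in> space borel \<rightarrow> radon_measures"
    using point_measure_radon[OF scale_dirac_point] by auto
  show "(\<lambda>x. scale_measure (of_nat n) (dirac x)) \<in> space borel \<rightarrow> point_measures"
    using scale_dirac_point by auto
  fix Y :: "'a measure set" assume "Y \<in> {U. openin vague_topology U}"
  then have "generate_topology_on
      {{\<mu> \<in> radon_measures. (\<integral>x. f x \<partial>\<mu>) \<in> U} | f U. f \<in> vague_test_functions \<and> open U} Y"
    by (simp add: vague_topology_def openin_topology_generated_by_iff)
  then have "open ((\<lambda>x. scale_measure (of_nat n) (dirac x)) -` Y)"
  proof induction
    case (UN K)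
    then show ?case by (auto simp: vimage_Union)
  next
    case (Basis S)
    then obtain f U where f: "f \<in> vague_test_functions" and U: "open U"
      and S: "S = {\<mu> \<in> radon_measures. (\<integral>x. f x \<partial>\<mu>) \<in> U}" by blast
    have fc: "continuous_on UNIV f" using f by (simp add: vague_test_functions_def)
    have "(\<lambda>x. scale_measure (of_nat n) (dirac x)) -` S = (\<lambda>x. real n * f x) -` U"
      using S point_measure_radon[OF scale_dirac_point]
      by (auto simp: integral_scale_dirac borel_measurable_continuous_onI[OF fc])
    moreover have "open ((\<lambda>x. real n * f x) -` U)"
      by (intro open_vimage U continuous_intros fc)
    ultimately show ?case by simp
  qed (auto simp: vimage_Int)
  then show "(\<lambda>x. scale_measure (of_nat n) (dirac x)) -` Y \<inter> space borel \<in> sets borel" by simp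
qed

text \<open>
  The set \<open>B\<close> may stay fixed while \<open>x\<close> varies, which turns the evaluation of the kernel
  at the moving set \<open>{x}\<close> into one at a fixed set and makes the excess measurable in \<open>x\<close>.
\<close>
lemma atom_excess_eq:
  assumes ker: "\<And>\<mu>. \<mu> \<in> point_measures \<Longrightarrow> \<pi> \<mu> \<in> radon_measures"
    and loc: "local_kernel \<pi>" and B: "B \<in> sets borel" "bounded B" "x \<in> B"
  shows "atom_excess \<pi> x n =
    measure (\<pi> (scale_measure (of_nat n) (dirac x))) B - measure (\<pi> (null_measure borel)) B"
proof -
  have "emeasure (\<pi> (scale_measure (of_nat n) (dirac x))) (B - {x}) = emeasure (\<pi> (null_measure borel)) (B - {x})"
    using local_kernel_add_diracs[OF loc null_measure_point, of "B - {x}" x n] B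
    by (simp add: add_null_measure)
  then show ?thesis
    using measure_diff_finite_sum[OF ker[OF scale_dirac_point] B(1,2), of "{x}" n x]
      measure_diff_finite_sum[OF ker[OF null_measure_point] B(1,2), of "{x}"] B(3)
    by (simp add: atom_excess_def measure_def)
qed

lemma measurable_atom_excess:
  fixes \<pi> :: "'a::polish_space measure \<Rightarrow> 'a measure"
  assumes ker: "radon_kernel \<pi>" and loc: "local_kernel \<pi>"
  shows "(\<lambda>(x, n). atom_excess \<pi> x n) \<in> borel_measurable (borel \<Otimes>\<^sub>M count_space UNIV)"
proof -
  have rad: "\<pi> \<mu> \<in> radon_measures" if "\<mu> \<in> point_measures" for \<mu>
    using ker that by (simp add: radon_kernel_def)
  define a :: 'a where "a = undefined"
  \<comment> \<open>The moving set \<open>{x}\<close> is replaced by fixed balls. By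
    \<open>atom_excess_eq\<close> the value is already exact as soon as the ball contains
    \<open>x\<close>.\<close>
  define g where "g n k x = measure (\<pi> (scale_measure (of_nat n) (dirac x))) (ball a (real k))
      - measure (\<pi> (null_measure borel)) (ball a (real k))" for n k x
  have g: "g n k \<in> borel_measurable borel" for n k
  proof -
    have "(\<lambda>\<mu>. emeasure (\<pi> \<mu>) (ball a (real k))) \<in> borel_measurable point_measure_space"
      using ker by (simp add: radon_kernel_def)
    from measurable_compose[OF measurable_scale_dirac this] show ?thesis
      unfolding g_def measure_def by measurable
  qed
  have "(\<lambda>x. atom_excess \<pi> x n) \<in> borel_measurable borel" for n
  proof (rule borel_measurable_LIMSEQ_real[where u = "g n"])
    fix x :: 'a
    obtain N :: nat where "dist a x < real N" using reals_Archimedean2 by blast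
    then have "g n k x = atom_excess \<pi> x n" if "k \<ge> N" for k
      using that atom_excess_eq[OF rad loc, of "ball a (real k)" x n] by (simp add: g_def)
    then show "(\<lambda>k. g n k x) \<longlonglongrightarrow> atom_excess \<pi> x n"
      by (intro tendsto_eventually) (auto simp: eventually_sequentially)
  qed (rule g)
  then have "(\<lambda>p. atom_excess \<pi> (fst p) n) \<in>
      borel_measurable (borel \<Otimes>\<^sub>M (count_space UNIV :: nat measure))" for n
    by (rule measurable_compose[OF measurable_fst])
  \<comment> \<open>The second variable is countable, so measurability for each fixed
    \<open>n\<close> gives joint measurability.\<close>
  then have "(\<lambda>p. atom_excess \<pi> (fst p) (snd p)) \<in>
      borel_measurable (borel \<Otimes>\<^sub>M (count_space UNIV :: nat measure))"
    by (rule measurable_compose_countable'[where f = "\<lambda>n p. atom_excess \<pi> (fst p) n"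
          and g = snd and I = UNIV]) simp_all
  then show ?thesis by (simp add: case_prod_beta')
qed

section \<open>Uniqueness of the representation\<close>

lemma measure_support_scale_dirac:
  "n \<ge> 1 \<Longrightarrow> measure_support (scale_measure (of_nat n) (dirac (x::'a::polish_space))) = {x}"
proof (intro set_eqI iffI)
  fix z assume z: "z \<in> measure_support (scale_measure (of_nat n) (dirac x))"
  show "z \<in> {x}"
  proof (rule ccontr)
    assume "z \<notin> {x}"
    then have "open (- {x})" "z \<in> - {x}" by auto
    then have "0 < emeasure (scale_measure (of_nat n) (dirac x)) (- {x})"
      using z unfolding measure_support_def by blast
    then show False by simp
  qed
qed (auto simp: measure_support_def)

lemma kernel_representation_null:
  fixes \<pi> :: "'a::polish_space measure \<Rightarrow> 'a measure"
  assumes "kernel_representation \<pi> \<rho> c" "B \<in> sets borel" "bounded B"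
  shows "measure (\<pi> (null_measure borel)) B = measure \<rho> B"
proof -
  have "measure_support (null_measure borel :: 'a measure) = {}"
    by (auto simp: measure_support_def)
  moreover have "measure (\<pi> (null_measure borel)) B = measure \<rho> B +
      (\<Sum>x\<in>measure_support (null_measure borel) \<inter> B. c x (nat \<lfloor>measure (null_measure borel) {x}\<rfloor>))"
    using assms null_measure_point unfolding kernel_representation_def by blast
  ultimately show ?thesis by simp
qed

text \<open>The support is the single point \<open>x\<close>, so the sum has one term. At
  \<open>n = 0\<close> the support is empty and no condition on \<open>c x 0\<close> arises.\<close>

lemma kernel_representation_scale_dirac:
  assumes "kernel_representation \<pi> \<rho> c" "n \<ge> 1"
  shows "measure (\<pi> (scale_measure (of_nat n) (dirac x))) {x} = measure \<rho> {x} + c x n"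
proof -
  have "measure (scale_measure (of_nat n) (dirac x)) {x} = real n"
    by (simp add: measure_def)
  then show ?thesis
    using assms scale_dirac_point[of n x]
    by (simp add: kernel_representation_def measure_support_scale_dirac)
qed

text \<open>The sum telescopes, and its lower end is the kernel at the zero measure, the multiple of
  the Dirac measure by 0.\<close>

lemma sum_kernel_increment:
  "(\<Sum>k=1..n. kernel_increment \<pi> x k) = atom_excess \<pi> x n"
proof -
  have "scale_measure 0 (dirac x) = null_measure borel"
    by (rule measure_eqI) simp_all
  then show ?thesis
    by (induction n) (simp_all add: kernel_increment_def atom_excess_def)
qed

theorem proposition3p1:
  fixes \<pi> :: "'a::polish_space measure \<Rightarrow> 'a measure"
  assumes kernel: "radon_kernel \<pi>"
    and cocycle: "\<forall>\<mu>\<in>point_measures. \<forall>A\<in>sets (borel \<Otimes>\<^sub>M borel).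
      (\<integral>\<^sup>+ y. (\<integral>\<^sup>+ x. indicator A (x, y) \<partial>\<pi> (add_measure \<mu> (dirac y))) \<partial>\<pi> \<mu>) =
      (\<integral>\<^sup>+ x. (\<integral>\<^sup>+ y. indicator A (x, y) \<partial>\<pi> (add_measure \<mu> (dirac x))) \<partial>\<pi> \<mu>)"
    and locality: "\<forall>y. \<forall>\<mu>\<in>point_measures. \<forall>B\<in>sets borel. B \<subseteq> UNIV - {y} \<longrightarrow>
      emeasure (\<pi> (add_measure \<mu> (dirac y))) B = emeasure (\<pi> \<mu>) B"
    and continuous: "vaguely_continuous \<pi>"
  shows
    "(\<exists>\<rho> c. \<rho> \<in> radon_measures \<and>
        (\<lambda>(x, n). c x n) \<in> borel_measurable (borel \<Otimes>\<^sub>M count_space UNIV) \<and>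
        kernel_representation \<pi> \<rho> c) \<and>
     (\<forall>\<rho> c. \<rho> \<in> radon_measures \<and>
        (\<lambda>(x, n). c x n) \<in> borel_measurable (borel \<Otimes>\<^sub>M count_space UNIV) \<and>
        kernel_representation \<pi> \<rho> c \<longrightarrow>
          \<rho> = \<pi> (null_measure borel) \<and>
          (\<forall>x. \<forall>n\<ge>1. c x n = (\<Sum>k=1..n. kernel_increment \<pi> x k)))"
proof -
  have rad: "\<pi> \<mu> \<in> radon_measures" if "\<mu> \<in> point_measures" for \<mu>
    using kernel that by (simp add: radon_kernel_def)
  have loc: "local_kernel \<pi>"
    using locality by (simp add: local_kernel_def subset_Diff_insert)
  show ?thesis
  proof (intro conjI allI impI)
    \<comment> \<open>The witnesses are the kernel at the zero measure and
      \<open>atom_excess \<pi>\<close>.\<close>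
    show "\<exists>\<rho> c. \<rho> \<in> radon_measures \<and>
        (\<lambda>(x, n). c x n) \<in> borel_measurable (borel \<Otimes>\<^sub>M count_space UNIV) \<and>
        kernel_representation \<pi> \<rho> c"
      using rad[OF null_measure_point] measurable_atom_excess[OF kernel loc]
        kernel_representation_atom_excess[OF rad loc continuous] by blast
  next
    fix \<rho> c
    assume "\<rho> \<in> radon_measures \<and>
        (\<lambda>(x, n). c x n) \<in> borel_measurable (borel \<Otimes>\<^sub>M count_space UNIV) \<and>
        kernel_representation \<pi> \<rho> c"
    then have \<rho>: "\<rho> \<in> radon_measures" and rep: "kernel_representation \<pi> \<rho> c" by auto
    show eq: "\<rho> = \<pi> (null_measure borel)"
      by (rule radon_measure_eqI[OF \<rho> rad[OF null_measure_point]])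
        (simp add: kernel_representation_null[OF rep])
    \<comment> \<open>With \<rho> identified, evaluating the representation at \<open>n\<close>
      times the Dirac measure on \<open>{x}\<close> can be solved for \<open>c x n\<close>.\<close>
    show "c x n = (\<Sum>k=1..n. kernel_increment \<pi> x k)" if "n \<ge> 1" for x n
      using kernel_representation_scale_dirac[OF rep that, of x]
      unfolding sum_kernel_increment atom_excess_def eq by simp
  qed
qed

end
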